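(* Let $n_v\ge 1$, $N\ge 1$, and let $i_l,j_l,k_l$ ($l=1,\dots,n_v$) be integers modulo $N$ with $i_1=j_1=k_1=0$. Let $$H_4=\begin{bmatrix}1&\cdots&1\\ x^{i_1}&\cdots&x^{i_{n_v}}\\ x^{j_1}&\cdots&x^{j_{n_v}}\\ x^{k_1}&\cdots&x^{k_{n_v}}\end{bmatrix},$$ a $4N\times n_vN$ matrix. Write $[n_v]=\{1,\dots,n_v\}$. Then $\mathrm{girth}(H_4)>6$ if and only if, for all $l\in[n_v]$, each one of the sets $$\{i_l-i_s,\ j_l-j_s,\ k_l-k_s \mid s\in[n_v], s\neq l\},\qquad \{i_s,\ i_s-j_s+j_l,\ i_s-k_s+k_l\mid s\in[n_v], s\ne l\},$$ $$\{j_s,\ j_s-i_s+i_l,\ j_s-k_s+k_l\mid s\in[n_v], s\ne l\},\qquad \{k_s,\ k_s-i_s+i_l,\ k_s-j_s+j_l\mid s\in[n_v], s\ne l\}$$ is of maximal size.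
   Context: $x^r$ denotes the $N\times N$ circulant permutation matrix obtained from the identity by cyclically shifting to the left by $r$ positions; exponents are taken modulo $N$, and $1=x^0$ is the $N\times N$ identity. A set given by listed expressions is "of maximal size" if all the listed values (over all expressions and all index choices) are pairwise distinct modulo $N$; here each set must have exactly $3(n_v-1)$ elements in $\mathbb Z/N\mathbb Z$. The Tanner graph of a $0/1$ matrix is the bipartite graph with one check node per row, one variable node per column, and an edge for each entry equal to $1$; $\mathrm{girth}(M)$ is the length of a shortest cycle in the Tanner graph of $M$ ($+\infty$ if there is none). *)

theory Defs
  imports
    "Jordan_Normal_Form.Matrix"
    "HOL-Number_Theory.Cong"
    "HOL-Library.Extended_Nat"
begin

text \<open>
  Every row of the identity is moved cyclically to the left by \<open>r\<close> positions: the new entry in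
  column \<open>b\<close> is the old entry in column \<open>b + r\<close>, column indices being taken modulo \<open>N\<close>.
\<close>

definition circ_perm :: "nat \<Rightarrow> int \<Rightarrow> int mat" where
  "circ_perm N r = mat N N (\<lambda>(a, b). 1\<^sub>m N $$ (a, nat ((int b + r) mod int N)))"

text \<open>
  Block rows and block columns are numbered from 1, whereas matrix entries are numbered from 0.
\<close>

definition block_mat :: "nat \<Rightarrow> nat \<Rightarrow> nat \<Rightarrow> (nat \<Rightarrow> nat \<Rightarrow> 'a mat) \<Rightarrow> 'a mat" where
  "block_mat m n N B =
     mat (m * N) (n * N) (\<lambda>(a, b). B (a div N + 1) (b div N + 1) $$ (a mod N, b mod N))"

definition H4 ::
    "nat \<Rightarrow> nat \<Rightarrow> (nat \<Rightarrow> int) \<Rightarrow> (nat \<Rightarrow> int) \<Rightarrow> (nat \<Rightarrow> int) \<Rightarrow> int mat" where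
  "H4 n\<^sub>v N i j k =
     block_mat 4 n\<^sub>v N (\<lambda>r l.
       if r = 1 then 1\<^sub>m N
       else if r = 2 then circ_perm N (i l)
       else if r = 3 then circ_perm N (j l)
       else circ_perm N (k l))"

type_synonym 'v graph = "'v set \<times> 'v set set"

text \<open>Check nodes are tagged by \<open>Inl\<close>, variable nodes by \<open>Inr\<close>.\<close>

definition tanner_graph :: "'a::one mat \<Rightarrow> (nat + nat) graph" where
  "tanner_graph M =
     (Inl ` {..<dim_row M} \<union> Inr ` {..<dim_col M},
      {{Inl a, Inr b} | a b. a < dim_row M \<and> b < dim_col M \<and> M $$ (a, b) = 1})"

text \<open>
  A cycle is given by its distinct vertices in cyclic order, the first one not being repeated at
  the end; thus its length is the length of the list.
\<close>

definition is_cycle :: "'v graph \<Rightarrow> 'v list \<Rightarrow> bool" where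
  "is_cycle G c \<longleftrightarrow>
     3 \<le> length c \<and> distinct c \<and> set c \<subseteq> fst G \<and>
     (\<forall>t < length c. {c ! t, c ! (Suc t mod length c)} \<in> snd G)"

text \<open>The infimum over the empty set is \<open>\<infinity>\<close>, as required for acyclic graphs.\<close>

definition graph_girth :: "'v graph \<Rightarrow> enat" where
  "graph_girth G = (INF c \<in> {c. is_cycle G c}. enat (length c))"

definition girth :: "'a::one mat \<Rightarrow> enat" where
  "girth M = graph_girth (tanner_graph M)"

text \<open>
  Elements of \<open>\<int>/N\<int>\<close> are given by integer representatives. The sets \<open>A\<close> considered list three
  values for every index in \<open>{1..n}\<close> except one; having \<open>3 * (n - 1)\<close> residues means that all
  listed values are pairwise distinct modulo \<open>N\<close>.
\<close>

definition maximal_size :: "nat \<Rightarrow> nat \<Rightarrow> int set \<Rightarrow> bool" where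
  "maximal_size N n A \<longleftrightarrow> card ((\<lambda>z. z mod int N) ` A) = 3 * (n - 1)"

end

theory Submission
  imports Defs
begin

text \<open>
  The entries equal to 1 in the block with exponent \<open>x\<close> are those at \<open>(a, b)\<close> with
  \<open>a = b + x\<close> modulo \<open>N\<close>. Consecutive nodes of a 4-cycle or a 6-cycle of the Tanner graph
  therefore lie in distinct block rows, respectively block columns, and going once around such a
  cycle gives a vanishing alternating sum of exponents; conversely each such relation lifts to a
  cycle. For a block row \<open>q\<close> and a block column \<open>l\<close>, a coincidence among the values
  \<open>e q s - e r s + e r l\<close> for \<open>r \<noteq> q\<close>, \<open>s \<noteq> l\<close> is exactly such a relation: a 6-cycle
  through \<open>q\<close> and \<open>l\<close> if both indices differ, and a 4-cycle if one of them agrees.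
\<close>

section \<open>Short cycles of Tanner graphs\<close>

definition tanner_adj :: "'a::one mat \<Rightarrow> nat \<Rightarrow> nat \<Rightarrow> bool" where
  "tanner_adj M a b \<longleftrightarrow> a < dim_row M \<and> b < dim_col M \<and> M $$ (a, b) = 1"

text \<open>Row and column indices are compared only among themselves: the tags \<open>Inl\<close>
  and \<open>Inr\<close> keep nodes of different sides apart anyway.\<close>

definition four_cycle :: "('r \<Rightarrow> 'c \<Rightarrow> bool) \<Rightarrow> bool" where
  "four_cycle A \<longleftrightarrow> (\<exists>a1 a2 b1 b2. a1 \<noteq> a2 \<and> b1 \<noteq> b2 \<and>
     A a1 b1 \<and> A a2 b1 \<and> A a2 b2 \<and> A a1 b2)"

definition six_cycle :: "('r \<Rightarrow> 'c \<Rightarrow> bool) \<Rightarrow> bool" where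
  "six_cycle A \<longleftrightarrow> (\<exists>a1 a2 a3 b1 b2 b3. distinct [a1, a2, a3] \<and> distinct [b1, b2, b3] \<and>
     A a1 b1 \<and> A a2 b1 \<and> A a2 b2 \<and> A a3 b2 \<and> A a3 b3 \<and> A a1 b3)"

lemma tanner_edge_simps:
  "{Inl a, Inr b} \<in> snd (tanner_graph M) \<longleftrightarrow> tanner_adj M a b"
  "{Inr b, Inl a} \<in> snd (tanner_graph M) \<longleftrightarrow> tanner_adj M a b"
  "{Inl a, Inl a'} \<notin> snd (tanner_graph M)"
  "{Inr b, Inr b'} \<notin> snd (tanner_graph M)"
  by (auto simp: tanner_graph_def tanner_adj_def doubleton_eq_iff)

lemma tanner_vertex_simps:
  "Inl a \<in> fst (tanner_graph M) \<longleftrightarrow> a < dim_row M"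
  "Inr b \<in> fst (tanner_graph M) \<longleftrightarrow> b < dim_col M"
  by (auto simp: tanner_graph_def)

text \<open>On an explicit list \<open>rotate1\<close> evaluates by simplification, which replaces
  the indexing modulo the length by one edge condition per node.\<close>

lemma is_cycle_iff_rotate1:
  "is_cycle G c \<longleftrightarrow> 3 \<le> length c \<and> distinct c \<and> set c \<subseteq> fst G \<and>
     list_all2 (\<lambda>u v. {u, v} \<in> snd G) c (rotate1 c)"
  by (auto simp: is_cycle_def list_all2_conv_all_nth nth_rotate1)

text \<open>The graph is bipartite: around an odd cycle some two neighbours would lie on the same
  side.\<close>

lemma not_tanner_cycle_3: "\<not> is_cycle (tanner_graph M) [u, v, w]"
  by (cases u; cases v; cases w) (auto simp: is_cycle_iff_rotate1 tanner_edge_simps)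

lemma not_tanner_cycle_5: "\<not> is_cycle (tanner_graph M) [u, v, w, x, y]"
  by (cases u; cases v; cases w; cases x; cases y)
     (simp_all add: is_cycle_iff_rotate1 tanner_edge_simps)

lemma tanner_cycle_4:
  assumes "is_cycle (tanner_graph M) [u, v, w, x]"
  shows "four_cycle (tanner_adj M)"
  using assms unfolding four_cycle_def
  by (cases u; cases v; cases w; cases x)
     (simp_all add: is_cycle_iff_rotate1 tanner_edge_simps, blast+)

lemma tanner_cycle_6:
  assumes "is_cycle (tanner_graph M) [u, v, w, x, y, z]"
  shows "six_cycle (tanner_adj M)"
proof (cases u)
  case (Inl a1)
  then obtain b1 a2 b2 a3 b3
    where "v = Inr b1" "w = Inl a2" "x = Inr b2" "y = Inl a3" "z = Inr b3"
    using assms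
    by (cases v; cases w; cases x; cases y; cases z)
       (simp_all add: is_cycle_iff_rotate1 tanner_edge_simps)
  with Inl assms have "distinct [a1, a2, a3]" "distinct [b1, b2, b3]"
    "tanner_adj M a1 b1" "tanner_adj M a2 b1" "tanner_adj M a2 b2"
    "tanner_adj M a3 b2" "tanner_adj M a3 b3" "tanner_adj M a1 b3"
    by (auto simp: is_cycle_iff_rotate1 tanner_edge_simps)
  then show ?thesis unfolding six_cycle_def by blast
next
  \<comment> \<open>A cycle starting at a variable node is read from its second node on, so its
    first node takes the role of the last column.\<close>
  case (Inr b3)
  then obtain a1 b1 a2 b2 a3
    where "v = Inl a1" "w = Inr b1" "x = Inl a2" "y = Inr b2" "z = Inl a3"
    using assms
    by (cases v; cases w; cases x; cases y; cases z)
       (simp_all add: is_cycle_iff_rotate1 tanner_edge_simps)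
  with Inr assms have "distinct [a1, a2, a3]" "distinct [b1, b2, b3]"
    "tanner_adj M a1 b1" "tanner_adj M a2 b1" "tanner_adj M a2 b2"
    "tanner_adj M a3 b2" "tanner_adj M a3 b3" "tanner_adj M a1 b3"
    by (auto simp: is_cycle_iff_rotate1 tanner_edge_simps)
  then show ?thesis unfolding six_cycle_def by blast
qed

text \<open>Of the lengths 3 to 6 only the even ones can occur, and an even cycle may be read from a
  check node.\<close>

lemma girth_gt_6_iff:
  "girth M > 6 \<longleftrightarrow> \<not> four_cycle (tanner_adj M) \<and> \<not> six_cycle (tanner_adj M)"
proof -
  \<comment> \<open>A non-strict bound passes to all members of an infimum, also when there is no
    cycle and the infimum is \<infinity>.\<close>
  have "(6::enat) < x \<longleftrightarrow> enat 7 \<le> x" for x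
    using Suc_ile_eq[of 6 x] by (simp add: numeral_eq_enat)
  then have girth_iff: "girth M > 6 \<longleftrightarrow> (\<forall>c. is_cycle (tanner_graph M) c \<longrightarrow> 7 \<le> length c)"
    by (simp add: girth_def graph_girth_def le_INF_iff)
  show ?thesis
  proof
    assume "girth M > 6"
    then have long: "7 \<le> length c" if "is_cycle (tanner_graph M) c" for c
      using girth_iff that by blast
    have "\<not> four_cycle (tanner_adj M)"
    proof
      assume "four_cycle (tanner_adj M)"
      then obtain a1 a2 b1 b2 where "a1 \<noteq> a2" "b1 \<noteq> b2"
        "tanner_adj M a1 b1" "tanner_adj M a2 b1" "tanner_adj M a2 b2" "tanner_adj M a1 b2"
        unfolding four_cycle_def by blast
      then have "is_cycle (tanner_graph M) [Inl a1, Inr b1, Inl a2, Inr b2]"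
        by (simp add: is_cycle_iff_rotate1 tanner_edge_simps tanner_vertex_simps)
           (simp add: tanner_adj_def)
      from long[OF this] show False by simp
    qed
    moreover have "\<not> six_cycle (tanner_adj M)"
    proof
      assume "six_cycle (tanner_adj M)"
      then obtain a1 a2 a3 b1 b2 b3 where "distinct [a1, a2, a3]" "distinct [b1, b2, b3]"
        "tanner_adj M a1 b1" "tanner_adj M a2 b1" "tanner_adj M a2 b2"
        "tanner_adj M a3 b2" "tanner_adj M a3 b3" "tanner_adj M a1 b3"
        unfolding six_cycle_def by blast
      then have "is_cycle (tanner_graph M) [Inl a1, Inr b1, Inl a2, Inr b2, Inl a3, Inr b3]"
        by (simp add: is_cycle_iff_rotate1 tanner_edge_simps tanner_vertex_simps)
           (simp add: tanner_adj_def)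
      from long[OF this] show False by simp
    qed
    ultimately show "\<not> four_cycle (tanner_adj M) \<and> \<not> six_cycle (tanner_adj M)" ..
  next
    assume no_short: "\<not> four_cycle (tanner_adj M) \<and> \<not> six_cycle (tanner_adj M)"
    have "7 \<le> length c" if c: "is_cycle (tanner_graph M) c" for c
    proof (rule ccontr)
      assume "\<not> 7 \<le> length c"
      moreover have "3 \<le> length c" using c by (simp add: is_cycle_def)
      ultimately consider "length c = 3" | "length c = 4" | "length c = 5" | "length c = 6"
        by linarith
      then show False
      proof cases
        case 1
        then obtain u v w where "c = [u, v, w]"
          by (auto simp: numeral_eq_Suc length_Suc_conv)
        then show False using c not_tanner_cycle_3 by blast
      next
        case 2
        then obtain u v w x where "c = [u, v, w, x]"
          by (auto simp: numeral_eq_Suc length_Suc_conv)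
        then show False using c no_short tanner_cycle_4 by blast
      next
        case 3
        then obtain u v w x y where "c = [u, v, w, x, y]"
          by (auto simp: numeral_eq_Suc length_Suc_conv)
        then show False using c not_tanner_cycle_5 by blast
      next
        case 4
        then obtain u v w x y z where "c = [u, v, w, x, y, z]"
          by (auto simp: numeral_eq_Suc length_Suc_conv)
        then show False using c no_short tanner_cycle_6 by blast
      qed
    qed
    then show "girth M > 6" using girth_iff by blast
  qed
qed

section \<open>Quasi-cyclic matrices\<close>

text \<open>Arbitrary exponents \<open>e r l\<close> make all block rows alike, so the four sets of
  the theorem become one family indexed by a base row.\<close>

definition qc_mat :: "nat \<Rightarrow> nat \<Rightarrow> nat \<Rightarrow> (nat \<Rightarrow> nat \<Rightarrow> int) \<Rightarrow> int mat" where
  "qc_mat m n N e = block_mat m n N (\<lambda>r l. circ_perm N (e r l))"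

lemma circ_perm_eq_1_iff:
  assumes "a < N" and "b < N"
  shows "circ_perm N x $$ (a, b) = 1 \<longleftrightarrow> [int a = int b + x] (mod int N)"
proof -
  have "nat ((int b + x) mod int N) < N"
    using assms by (simp add: nat_less_iff)
  then show ?thesis
    using assms by (auto simp: circ_perm_def cong_def nat_eq_iff)
qed

lemma circ_perm_0: "circ_perm N 0 = 1\<^sub>m N"
  by (rule eq_matI) (auto simp: circ_perm_def simp flip: zmod_int)

lemma less_mult_iff_div: "N > 0 \<Longrightarrow> a < m * N \<longleftrightarrow> a div N < m" for a m N :: nat
  by (simp add: div_less_iff_less_mult)

text \<open>Since \<open>a\<close> and \<open>a mod N\<close> are congruent, the condition on
  positions inside a block can be stated for the global indices.\<close>

lemma tanner_adj_qc_mat: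
  assumes "N > 0"
  shows "tanner_adj (qc_mat m n N e) a b \<longleftrightarrow>
    a div N < m \<and> b div N < n \<and>
    [int a = int b + e (a div N + 1) (b div N + 1)] (mod int N)"
  using assms
  by (auto simp: tanner_adj_def qc_mat_def block_mat_def circ_perm_eq_1_iff less_mult_iff_div
      cong_def zmod_int mod_simps)

text \<open>The node with prescribed block and residue, used to lift relations to cycles. Blocks
  count from 1, hence \<open>r - 1\<close>; truncation at \<open>r = 0\<close> is why
  \<open>block_index_neq\<close> asks for positive block numbers.\<close>

definition block_index :: "nat \<Rightarrow> nat \<Rightarrow> int \<Rightarrow> nat" where
  "block_index N r x = (r - 1) * N + nat (x mod int N)"

lemma block_index_div: "N > 0 \<Longrightarrow> block_index N r x div N = r - 1"
  by (simp add: block_index_def nat_less_iff)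

lemma block_index_cong: "N > 0 \<Longrightarrow> [int (block_index N r x) = x] (mod int N)"
  by (simp add: block_index_def cong_def)

lemma block_index_neq:
  "N > 0 \<Longrightarrow> r \<ge> 1 \<Longrightarrow> r' \<ge> 1 \<Longrightarrow> r \<noteq> r' \<Longrightarrow> block_index N r x \<noteq> block_index N r' y"
  using block_index_div[of N r x] block_index_div[of N r' y] by auto

lemma tanner_adj_block_index:
  assumes "N > 0" and "r \<in> {1..m}" and "l \<in> {1..n}" and "[x = y + e r l] (mod int N)"
  shows "tanner_adj (qc_mat m n N e) (block_index N r x) (block_index N l y)"
proof -
  have "[int (block_index N r x) = x] (mod int N)"
    "[y + e r l = int (block_index N l y) + e r l] (mod int N)"
    by (rule block_index_cong[OF assms(1)],
        rule cong_add[OF cong_sym[OF block_index_cong[OF assms(1)]] cong_refl])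
  then have "[int (block_index N r x) = int (block_index N l y) + e r l] (mod int N)"
    using assms(4) cong_trans by blast
  then show ?thesis
    using assms(1-3) by (simp add: tanner_adj_qc_mat block_index_div) linarith
qed

section \<open>Short cycles as alternating sums of exponents\<close>

definition four_relation :: "nat \<Rightarrow> nat \<Rightarrow> nat \<Rightarrow> (nat \<Rightarrow> nat \<Rightarrow> int) \<Rightarrow> bool" where
  "four_relation m n N e \<longleftrightarrow> (\<exists>q r l s.
     [e q l - e r l + e r s - e q s = 0] (mod int N) \<and> q \<noteq> r \<and> l \<noteq> s \<and>
     q \<in> {1..m} \<and> r \<in> {1..m} \<and> l \<in> {1..n} \<and> s \<in> {1..n})"

text \<open>The closed walk is \<open>q\<close>, \<open>s\<close>, \<open>r\<close>,
  \<open>l\<close>, \<open>r'\<close>, \<open>s'\<close>, with \<open>l\<close> opposite to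
  \<open>q\<close>. The names are chosen so that the sum is the difference of the values of
  \<open>exponent_diff e q l\<close> at \<open>(r, s)\<close> and \<open>(r', s')\<close>.\<close>

definition six_relation :: "nat \<Rightarrow> nat \<Rightarrow> nat \<Rightarrow> (nat \<Rightarrow> nat \<Rightarrow> int) \<Rightarrow> bool" where
  "six_relation m n N e \<longleftrightarrow> (\<exists>q r r' l s s'.
     [e q s - e r s + e r l - e r' l + e r' s' - e q s' = 0] (mod int N) \<and>
     distinct [q, r, r'] \<and> distinct [l, s, s'] \<and>
     q \<in> {1..m} \<and> r \<in> {1..m} \<and> r' \<in> {1..m} \<and> l \<in> {1..n} \<and> s \<in> {1..n} \<and> s' \<in> {1..n})"

text \<open>A circulant permutation block has a single 1 in each column, so two ones in one column
  come from different block rows.\<close>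

lemma tanner_adj_same_col:
  assumes "N > 0" and "tanner_adj (qc_mat m n N e) a b" and "tanner_adj (qc_mat m n N e) a' b"
    and "a \<noteq> a'"
  shows "a div N \<noteq> a' div N"
proof
  assume eq: "a div N = a' div N"
  have "[int a = int a'] (mod int N)"
    using assms(2,3) eq by (simp add: tanner_adj_qc_mat[OF assms(1)] cong_def)
  then have "a mod N = a' mod N"
    by (simp add: cong_int_iff) (simp add: cong_def)
  then show False using eq \<open>a \<noteq> a'\<close> by (metis div_mult_mod_eq)
qed

lemma tanner_adj_same_row:
  assumes "N > 0" and "tanner_adj (qc_mat m n N e) a b" and "tanner_adj (qc_mat m n N e) a b'"
    and "b \<noteq> b'"
  shows "b div N \<noteq> b' div N"
proof
  assume eq: "b div N = b' div N"
  have "[int b + e (a div N + 1) (b div N + 1) = int b' + e (a div N + 1) (b div N + 1)] (mod int N)"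
    using assms(2,3) eq by (simp add: tanner_adj_qc_mat[OF assms(1)] cong_def)
  then have "b mod N = b' mod N"
    by (simp add: cong_add_rcancel cong_int_iff) (simp add: cong_def)
  then show False using eq \<open>b \<noteq> b'\<close> by (metis div_mult_mod_eq)
qed

lemma four_cycle_qc_mat_iff:
  assumes N: "N > 0"
  shows "four_cycle (tanner_adj (qc_mat m n N e)) \<longleftrightarrow> four_relation m n N e"
proof
  let ?A = "tanner_adj (qc_mat m n N e)"
  assume "four_cycle ?A"
  then obtain a1 a2 b1 b2 where ne: "a1 \<noteq> a2" "b1 \<noteq> b2"
    and adj: "?A a1 b1" "?A a2 b1" "?A a2 b2" "?A a1 b2"
    unfolding four_cycle_def by blast
  define q r l s where "q = a1 div N + 1" "r = a2 div N + 1" "l = b1 div N + 1" "s = b2 div N + 1"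
  note defs = this
  have "q \<noteq> r" "l \<noteq> s"
    using tanner_adj_same_col[OF N adj(1,2)] tanner_adj_same_row[OF N adj(1,4)] ne
    by (simp_all add: defs)
  moreover have "q \<in> {1..m}" "r \<in> {1..m}" "l \<in> {1..n}" "s \<in> {1..n}"
    using adj by (auto simp: defs tanner_adj_qc_mat[OF N])
  moreover have "[e q l - e r l + e r s - e q s = 0] (mod int N)"
  proof -
    have h: "int N dvd int a1 - (int b1 + e q l)" "int N dvd int a2 - (int b1 + e r l)"
      "int N dvd int a2 - (int b2 + e r s)" "int N dvd int a1 - (int b2 + e q s)"
      using adj by (auto simp: defs tanner_adj_qc_mat[OF N] cong_iff_dvd_diff)
    \<comment> \<open>Each node lies on two consecutive edges, which enter with opposite signs; all
      node indices cancel and only exponents remain.\<close>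
    from dvd_diff[OF dvd_diff[OF h(2,1)] dvd_diff[OF h(3,4)]]
    show ?thesis by (simp add: cong_0_iff algebra_simps)
  qed
  ultimately show "four_relation m n N e" unfolding four_relation_def by blast
next
  let ?A = "tanner_adj (qc_mat m n N e)"
  assume "four_relation m n N e"
  then obtain q r l s where mem: "q \<in> {1..m}" "r \<in> {1..m}" "l \<in> {1..n}" "s \<in> {1..n}"
    and ne: "q \<noteq> r" "l \<noteq> s" and rel: "[e q l - e r l + e r s - e q s = 0] (mod int N)"
    unfolding four_relation_def by blast
  \<comment> \<open>Starting from residue 0 in block column \<open>l\<close>, the first three edges
    force the residues of the other nodes; \<open>y\<close> is the one in block column
    \<open>s\<close>. Only the closing edge uses the relation.\<close>
  define y where "y = e r l - e r s"
  have "?A (block_index N q (e q l)) (block_index N l 0)"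
    "?A (block_index N r (e r l)) (block_index N l 0)"
    "?A (block_index N r (e r l)) (block_index N s y)"
    using mem by (auto intro!: tanner_adj_block_index[OF N] simp: y_def)
  moreover have "?A (block_index N q (e q l)) (block_index N s y)"
    using mem rel
    by (auto intro!: tanner_adj_block_index[OF N] simp: y_def cong_iff_dvd_diff algebra_simps)
  moreover have "block_index N q (e q l) \<noteq> block_index N r (e r l)"
    "block_index N l 0 \<noteq> block_index N s y"
    using mem ne by (simp_all add: block_index_neq[OF N])
  ultimately show "four_cycle ?A" unfolding four_cycle_def by blast
qed

lemma six_cycle_qc_mat_iff:
  assumes N: "N > 0"
  shows "six_cycle (tanner_adj (qc_mat m n N e)) \<longleftrightarrow> six_relation m n N e"
proof
  let ?A = "tanner_adj (qc_mat m n N e)"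
  assume "six_cycle ?A"
  then obtain a1 a2 a3 b1 b2 b3 where ne: "distinct [a1, a2, a3]" "distinct [b1, b2, b3]"
    and adj: "?A a1 b1" "?A a2 b1" "?A a2 b2" "?A a3 b2" "?A a3 b3" "?A a1 b3"
    unfolding six_cycle_def by blast
  define q r r' where "q = a1 div N + 1" "r = a2 div N + 1" "r' = a3 div N + 1"
  define s l s' where "s = b1 div N + 1" "l = b2 div N + 1" "s' = b3 div N + 1"
  note defs = \<open>q = _\<close> \<open>r = _\<close> \<open>r' = _\<close> \<open>s = _\<close> \<open>l = _\<close> \<open>s' = _\<close>
  have "distinct [q, r, r']" "distinct [l, s, s']"
    using tanner_adj_same_col[OF N adj(1,2)] tanner_adj_same_col[OF N adj(3,4)]
      tanner_adj_same_col[OF N adj(5,6)] tanner_adj_same_row[OF N adj(2,3)]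
      tanner_adj_same_row[OF N adj(4,5)] tanner_adj_same_row[OF N adj(6,1)] ne
    by (auto simp: defs)
  moreover have "q \<in> {1..m}" "r \<in> {1..m}" "r' \<in> {1..m}" "l \<in> {1..n}" "s \<in> {1..n}" "s' \<in> {1..n}"
    using adj by (auto simp: defs tanner_adj_qc_mat[OF N])
  moreover have "[e q s - e r s + e r l - e r' l + e r' s' - e q s' = 0] (mod int N)"
  proof -
    have h: "int N dvd int a1 - (int b1 + e q s)" "int N dvd int a2 - (int b1 + e r s)"
      "int N dvd int a2 - (int b2 + e r l)" "int N dvd int a3 - (int b2 + e r' l)"
      "int N dvd int a3 - (int b3 + e r' s')" "int N dvd int a1 - (int b3 + e q s')"
      using adj by (auto simp: defs tanner_adj_qc_mat[OF N] cong_iff_dvd_diff)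
    from dvd_add[OF dvd_add[OF dvd_diff[OF h(2,1)] dvd_diff[OF h(4,3)]] dvd_diff[OF h(6,5)]]
    show ?thesis by (simp add: cong_0_iff algebra_simps)
  qed
  ultimately show "six_relation m n N e" unfolding six_relation_def by blast
next
  let ?A = "tanner_adj (qc_mat m n N e)"
  assume "six_relation m n N e"
  then obtain q r r' l s s' where mem: "q \<in> {1..m}" "r \<in> {1..m}" "r' \<in> {1..m}"
      "l \<in> {1..n}" "s \<in> {1..n}" "s' \<in> {1..n}"
    and ne: "distinct [q, r, r']" "distinct [l, s, s']"
    and rel: "[e q s - e r s + e r l - e r' l + e r' s' - e q s' = 0] (mod int N)"
    unfolding six_relation_def by blast
  \<comment> \<open>The walk starts at residue 0 in block column \<open>s\<close>; following it,
    \<open>y\<close>, \<open>x\<close> and \<open>z\<close> are the residues forced in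
    \<open>l\<close>, \<open>r'\<close> and \<open>s'\<close>. The relation closes the walk at block
    row \<open>q\<close>.\<close>
  define y x z where "y = e r s - e r l" "x = y + e r' l" "z = x - e r' s'"
  note defs = this
  let ?a1 = "block_index N q (e q s)" and ?a2 = "block_index N r (e r s)"
    and ?a3 = "block_index N r' x"
  let ?b1 = "block_index N s 0" and ?b2 = "block_index N l y" and ?b3 = "block_index N s' z"
  have "?A ?a1 ?b1" "?A ?a2 ?b1" "?A ?a2 ?b2" "?A ?a3 ?b2" "?A ?a3 ?b3"
    using mem by (auto intro!: tanner_adj_block_index[OF N] simp: defs)
  moreover have "?A ?a1 ?b3"
    using mem rel
    by (auto intro!: tanner_adj_block_index[OF N] simp: defs cong_iff_dvd_diff algebra_simps)
  moreover have "distinct [?a1, ?a2, ?a3]" "distinct [?b1, ?b2, ?b3]"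
    using mem ne by (simp_all add: block_index_neq[OF N])
  ultimately show "six_cycle ?A" unfolding six_cycle_def by blast
qed

section \<open>Coincidences of exponent differences\<close>

text \<open>The alternating sum along the path \<open>q\<close>, \<open>s\<close>, \<open>r\<close>,
  \<open>l\<close>. Two such paths with the same ends and equal sums modulo \<open>N\<close> give a
  closed walk with vanishing sum.\<close>

definition exponent_diff :: "(nat \<Rightarrow> nat \<Rightarrow> int) \<Rightarrow> nat \<Rightarrow> nat \<Rightarrow> nat \<times> nat \<Rightarrow> int" where
  "exponent_diff e q l = (\<lambda>(r, s). e q s - e r s + e r l)"

text \<open>
  Three block rows are needed to see a 4-cycle on the block rows \<open>r\<close>, \<open>r'\<close> and block columns
  \<open>l\<close>, \<open>s\<close> as a coincidence of the values at \<open>(r, s)\<close> and \<open>(r', s)\<close>: the base row \<open>q\<close> has to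
  be a third one.
\<close>

lemma no_relation_iff_inj_on:
  assumes "m \<ge> 3"
  shows "\<not> four_relation m n N e \<and> \<not> six_relation m n N e \<longleftrightarrow>
    (\<forall>l\<in>{1..n}. \<forall>q\<in>{1..m}.
      inj_on (\<lambda>p. exponent_diff e q l p mod int N) (({1..m} - {q}) \<times> ({1..n} - {l})))"
    (is "?L \<longleftrightarrow> ?R")
proof
  assume L: ?L
  show ?R
  proof (intro ballI inj_onI)
    fix l q p p'
    assume "l \<in> {1..n}" "q \<in> {1..m}" "p \<in> ({1..m} - {q}) \<times> ({1..n} - {l})"
      "p' \<in> ({1..m} - {q}) \<times> ({1..n} - {l})"
      and eq: "exponent_diff e q l p mod int N = exponent_diff e q l p' mod int N"
    moreover obtain r s r' s' where p: "p = (r, s)" "p' = (r', s')" by fastforce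
    ultimately have mem: "l \<in> {1..n}" "q \<in> {1..m}" "r \<in> {1..m}" "r' \<in> {1..m}"
        "s \<in> {1..n}" "s' \<in> {1..n}"
      and ne: "r \<noteq> q" "r' \<noteq> q" "s \<noteq> l" "s' \<noteq> l"
      by blast+
    from eq p have dvd: "int N dvd (e q s - e r s + e r l) - (e q s' - e r' s' + e r' l)"
      by (simp add: exponent_diff_def mod_eq_dvd_iff)
    show "p = p'"
    proof (rule ccontr)
      assume "p \<noteq> p'"
      with p consider "r = r'" "s \<noteq> s'" | "r \<noteq> r'" "s = s'" | "r \<noteq> r'" "s \<noteq> s'" by blast
      then show False
      proof cases
        case 1
        \<comment> \<open>With a common row \<open>r\<close> the terms in column \<open>l\<close>
          cancel, leaving a relation on rows \<open>q\<close>, \<open>r\<close> and columns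
          \<open>s\<close>, \<open>s'\<close>.\<close>
        have "[e q s - e r s + e r s' - e q s' = 0] (mod int N)"
          using dvd 1 by (simp add: cong_0_iff algebra_simps)
        then have "four_relation m n N e"
          unfolding four_relation_def using mem ne 1 by blast
        then show False using L by blast
      next
        case 2
        \<comment> \<open>With a common column \<open>s\<close> the terms in the base row
          \<open>q\<close> cancel, leaving rows \<open>r\<close>, \<open>r'\<close> and columns
          \<open>l\<close>, \<open>s\<close>.\<close>
        have "[e r l - e r' l + e r' s - e r s = 0] (mod int N)"
          using dvd 2 by (simp add: cong_0_iff algebra_simps)
        then have "four_relation m n N e"
          unfolding four_relation_def using mem ne 2 by blast
        then show False using L by blast
      next
        case 3
        have "[e q s - e r s + e r l - e r' l + e r' s' - e q s' = 0] (mod int N)"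
          using dvd by (simp add: cong_0_iff algebra_simps)
        moreover have "distinct [q, r, r']" "distinct [l, s, s']" using ne 3 by auto
        ultimately have "six_relation m n N e"
          unfolding six_relation_def using mem by blast
        then show False using L by blast
      qed
    qed
  qed
next
  assume R: ?R
  have inj: "(r, s) = (r', s')"
    if "l \<in> {1..n}" "q \<in> {1..m}" "r \<in> {1..m} - {q}" "r' \<in> {1..m} - {q}"
      "s \<in> {1..n} - {l}" "s' \<in> {1..n} - {l}"
      "int N dvd (e q s - e r s + e r l) - (e q s' - e r' s' + e r' l)" for l q r s r' s'
  proof (rule inj_onD)
    show "inj_on (\<lambda>p. exponent_diff e q l p mod int N) (({1..m} - {q}) \<times> ({1..n} - {l}))"
      using R that(1,2) by blast
    show "exponent_diff e q l (r, s) mod int N = exponent_diff e q l (r', s') mod int N"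
      using that(7) by (simp add: exponent_diff_def mod_eq_dvd_iff)
  qed (use that in auto)
  have "\<not> four_relation m n N e"
  proof
    assume "four_relation m n N e"
    then obtain r r' l s where mem: "r \<in> {1..m}" "r' \<in> {1..m}" "l \<in> {1..n}" "s \<in> {1..n}"
      and ne: "r \<noteq> r'" "l \<noteq> s" and rel: "[e r l - e r' l + e r' s - e r s = 0] (mod int N)"
      unfolding four_relation_def by blast
    have "card {r, r'} < card {1..m}" using assms ne by simp
    then have "\<not> {1..m} \<subseteq> {r, r'}" by (meson card_mono finite.emptyI finite_insert not_le)
    then obtain q where "q \<in> {1..m}" "q \<noteq> r" "q \<noteq> r'" by blast
    then show False
      using inj[of l q r r' s s] mem ne rel by (simp add: cong_0_iff algebra_simps)
  qed
  moreover have "\<not> six_relation m n N e"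
  proof
    assume "six_relation m n N e"
    then obtain q r r' l s s' where mem: "q \<in> {1..m}" "r \<in> {1..m}" "r' \<in> {1..m}"
        "l \<in> {1..n}" "s \<in> {1..n}" "s' \<in> {1..n}"
      and ne: "distinct [q, r, r']" "distinct [l, s, s']"
      and rel: "[e q s - e r s + e r l - e r' l + e r' s' - e q s' = 0] (mod int N)"
      unfolding six_relation_def by blast
    then show False
      using inj[of l q r r' s s'] by (simp add: cong_0_iff algebra_simps)
  qed
  ultimately show ?L ..
qed

lemma girth_qc_mat_gt_6_iff:
  assumes "N > 0" and "m \<ge> 3"
  shows "girth (qc_mat m n N e) > 6 \<longleftrightarrow>
    (\<forall>l\<in>{1..n}. \<forall>q\<in>{1..m}.
      inj_on (\<lambda>p. exponent_diff e q l p mod int N) (({1..m} - {q}) \<times> ({1..n} - {l})))"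
  unfolding girth_gt_6_iff four_cycle_qc_mat_iff[OF assms(1)] six_cycle_qc_mat_iff[OF assms(1)]
  by (rule no_relation_iff_inj_on[OF assms(2)])

text \<open>There are \<open>3 * (n - 1)\<close> index pairs, so the number of residues reaches this
  value exactly when listing followed by reduction modulo \<open>N\<close> is injective on
  them.\<close>

lemma maximal_size_iff_inj_on:
  assumes "l \<in> {1..n}" and "q \<in> {1..4}"
  shows "maximal_size N n (exponent_diff e q l ` (({1..4} - {q}) \<times> ({1..n} - {l}))) \<longleftrightarrow>
    inj_on (\<lambda>p. exponent_diff e q l p mod int N) (({1..4} - {q}) \<times> ({1..n} - {l}))"
proof -
  have "card (({1..4} - {q}) \<times> ({1..n} - {l})) = 3 * (n - 1)"
    using assms by (simp add: card_cartesian_product)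
  moreover have "finite (({1..4} - {q}) \<times> ({1..n} - {l}))" by simp
  ultimately show ?thesis
    by (simp only: maximal_size_def image_image inj_on_iff_eq_card)
qed

section \<open>Specialisation to the four block rows of \<open>H4\<close>\<close>

definition H4_exponent ::
    "(nat \<Rightarrow> int) \<Rightarrow> (nat \<Rightarrow> int) \<Rightarrow> (nat \<Rightarrow> int) \<Rightarrow> nat \<Rightarrow> nat \<Rightarrow> int" where
  "H4_exponent i j k r l =
     (if r = 1 then 0 else if r = 2 then i l else if r = 3 then j l else k l)"

lemma H4_eq_qc_mat: "H4 n N i j k = qc_mat 4 n N (H4_exponent i j k)"
  unfolding H4_def qc_mat_def
  by (rule arg_cong[where f = "block_mat 4 n N"])
     (auto simp: H4_exponent_def circ_perm_0 fun_eq_iff)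

text \<open>The exponents of block row 1 are 0. Hence base row 1 yields plain differences, and for
  any other base row the choice \<open>r = 1\<close> yields the bare values \<open>i s\<close>,
  \<open>j s\<close> or \<open>k s\<close>.\<close>

lemma H4_exponent_diff_image:
  fixes i j k :: "nat \<Rightarrow> int" and n :: nat
  defines "D \<equiv> \<lambda>q l. exponent_diff (H4_exponent i j k) q l ` (({1..4} - {q}) \<times> ({1..n} - {l}))"
  shows "D 1 l = (\<Union>s \<in> {1..n} - {l}. {i l - i s, j l - j s, k l - k s})"
    and "D 2 l = (\<Union>s \<in> {1..n} - {l}. {i s, i s - j s + j l, i s - k s + k l})"
    and "D 3 l = (\<Union>s \<in> {1..n} - {l}. {j s, j s - i s + i l, j s - k s + k l})"
    and "D 4 l = (\<Union>s \<in> {1..n} - {l}. {k s, k s - i s + i l, k s - j s + j l})"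
proof -
  have rows: "{1..4} - {1} = {2, 3, 4::nat}" "{1..4} - {2} = {1, 3, 4::nat}"
    "{1..4} - {3} = {1, 2, 4::nat}" "{1..4} - {4} = {1, 2, 3::nat}"
    by auto
  have D: "D q l = (\<Union>s \<in> {1..n} - {l}. (\<lambda>r. H4_exponent i j k q s - H4_exponent i j k r s
      + H4_exponent i j k r l) ` ({1..4} - {q}))" for q
    by (auto simp: D_def exponent_diff_def)
  show "D 1 l = (\<Union>s \<in> {1..n} - {l}. {i l - i s, j l - j s, k l - k s})"
    "D 2 l = (\<Union>s \<in> {1..n} - {l}. {i s, i s - j s + j l, i s - k s + k l})"
    "D 3 l = (\<Union>s \<in> {1..n} - {l}. {j s, j s - i s + i l, j s - k s + k l})"
    "D 4 l = (\<Union>s \<in> {1..n} - {l}. {k s, k s - i s + i l, k s - j s + j l})"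
    unfolding D rows by (simp_all add: H4_exponent_def)
qed

theorem theorem34:
  fixes n\<^sub>v N :: nat and i j k :: "nat \<Rightarrow> int"
  assumes "n\<^sub>v \<ge> 1" and "N \<ge> 1"
    and "[i 1 = 0] (mod int N)" and "[j 1 = 0] (mod int N)" and "[k 1 = 0] (mod int N)"
  shows "girth (H4 n\<^sub>v N i j k) > 6 \<longleftrightarrow>
    (\<forall>l \<in> {1..n\<^sub>v}.
       maximal_size N n\<^sub>v
         (\<Union>s \<in> {1..n\<^sub>v} - {l}. {i l - i s, j l - j s, k l - k s}) \<and>
       maximal_size N n\<^sub>v
         (\<Union>s \<in> {1..n\<^sub>v} - {l}. {i s, i s - j s + j l, i s - k s + k l}) \<and>
       maximal_size N n\<^sub>v
         (\<Union>s \<in> {1..n\<^sub>v} - {l}. {j s, j s - i s + i l, j s - k s + k l}) \<and>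
       maximal_size N n\<^sub>v
         (\<Union>s \<in> {1..n\<^sub>v} - {l}. {k s, k s - i s + i l, k s - j s + j l}))"
proof -
  let ?D = "\<lambda>q l. exponent_diff (H4_exponent i j k) q l ` (({1..4} - {q}) \<times> ({1..n\<^sub>v} - {l}))"
  have four: "{1..4} = {1, 2, 3, 4::nat}" by auto
  have "N > 0" "(4::nat) \<ge> 3" using assms(2) by simp_all
  have "girth (H4 n\<^sub>v N i j k) > 6 \<longleftrightarrow>
      (\<forall>l\<in>{1..n\<^sub>v}. \<forall>q\<in>{1..4}. maximal_size N n\<^sub>v (?D q l))"
    unfolding H4_eq_qc_mat girth_qc_mat_gt_6_iff[OF \<open>N > 0\<close> \<open>4 \<ge> 3\<close>]
    by (intro ball_cong refl maximal_size_iff_inj_on[symmetric])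
  \<comment> \<open>Only the range of \<open>q\<close> is enumerated; the \<open>{1..4}\<close>
    inside \<open>?D\<close> keeps the form in which \<open>H4_exponent_diff_image\<close> rewrites
    it.\<close>
  also have "\<dots> \<longleftrightarrow> (\<forall>l\<in>{1..n\<^sub>v}. \<forall>q\<in>{1, 2, 3, 4}. maximal_size N n\<^sub>v (?D q l))"
    by (simp only: four[symmetric])
  also have "\<dots> \<longleftrightarrow> (\<forall>l\<in>{1..n\<^sub>v}. maximal_size N n\<^sub>v (?D 1 l) \<and> maximal_size N n\<^sub>v (?D 2 l) \<and>
      maximal_size N n\<^sub>v (?D 3 l) \<and> maximal_size N n\<^sub>v (?D 4 l))"
    by (simp only: ball_simps simp_thms)
  finally show ?thesis unfolding H4_exponent_diff_image .
qed

end
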